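(* We have $\mathrm{ex}^{(1)}(6;M_2)=10$ and $$\mathrm{Ex}^{(1)}(6;M_2)=\{S_6,\ K_5\cup K_1\}\cup\{H_i(6): i=1,\dots,11\}.$$
   Context: A 3-graph $H$ is a finite vertex set $V(H)$ together with a set of 3-element subsets of $V(H)$, called edges; $H$ is identified with its edge set. All 3-graphs are considered up to isomorphism; families $\mathrm{Ex}^{(1)}$ are sets of isomorphism types. $H\cup sK_1$ denotes the 3-graph obtained from $H$ by adding $s$ isolated vertices. $M_2$ is the 3-graph consisting of two disjoint edges. $\mathrm{ex}^{(1)}(n;M_2)$ is the maximum number of edges of an $n$-vertex 3-graph containing no copy of $M_2$ (i.e. an intersecting 3-graph), and $\mathrm{Ex}^{(1)}(n;M_2)$ is the family of $n$-vertex 3-graphs containing no copy of $M_2$ that attain this maximum. Specific 3-graphs. $S_6$ is the 6-vertex 3-graph of all 10 triples containing one fixed vertex. $K_5$ is the 3-graph of all 10 triples on 5 vertices. Let $V=\{x,y,z,v,w,u\}$ be a set of six different vertices, and for $A\subset V$ let $\mathrm{up}(A)=\{f\in\binom V3: f\supset A\}$. Define $H_1(6)=\mathrm{up}(\{x,y\})\cup\mathrm{up}(\{x,z\})\cup\mathrm{up}(\{x,v\})\cup\{\{y,z,v\}\}$; $H_2(6)=\mathrm{up}(\{x,y\})\cup\mathrm{up}(\{x,z\})\cup\mathrm{up}(\{y,z\})$; $H_3(6)=\mathrm{up}(\{x,y\})\cup\mathrm{up}(\{x,z\})\cup\{\{x,v,w\},\{y,z,w\},\{y,z,v\}\}$;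 $H_4(6)=\mathrm{up}(\{x,y\})\cup\{\{x,v,z\},\{x,w,z\},\{x,v,w\},\{y,z,w\},\{y,z,v\},\{y,v,w\}\}$; $H_5(6)=\mathrm{up}(\{x,y\})\cup\{\{x,v,z\},\{x,w,u\},\{x,v,w\},\{y,z,w\},\{y,u,v\},\{y,v,w\}\}$; $H_6(6)=\mathrm{up}(\{x,y\})\cup\{\{x,v,z\},\{x,w,u\},\{x,v,w\},\{y,z,w\},\{y,u,v\},\{x,z,u\}\}$. Let $U=\{x_1,x_2,x_3,y_1,y_2,y_3\}$ (six different vertices). The triangle is $C_3=\{\{x_1,y_3,x_2\},\{x_1,y_2,x_3\},\{x_2,y_1,x_3\}\}$. Put $A_1=\{\{x_i,y_i,y_j\}: i,j\in\{1,2,3\}, i\ne j\}$ (6 triples); $A_2=\{\{x_i,x_j,y_j\}: i,j\in\{1,2,3\}, i\neq j\}$ (6 triples); $A_3=(A_1\setminus\{\{x_1,y_1,y_2\}\})\cup\{\{x_2,x_3,y_3\}\}$; $A_4=(A_1\setminus\{\{x_1,y_1,y_2\},\{x_1,y_1,y_3\}\})\cup\{\{x_2,x_3,y_3\},\{x_2,x_3,y_2\}\}$. On vertex set $U$ define $H_7(6)=C_3\cup\{\{x_1,x_2,x_3\}\}\cup A_1$ and, for $i=8,9,10,11$, $H_i(6)=C_3\cup\{\{y_1,y_2,y_3\}\}\cup A_{i-7}$. *)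

theory Defs
  imports Main
begin

datatype 'a hypergraph = Hypergraph (verts: "'a set") (edges: "'a set set")

definition triples :: "'a set \<Rightarrow> 'a set set" where
  "triples V = {e. e \<subseteq> V \<and> card e = 3}"

definition is_3graph :: "'a hypergraph \<Rightarrow> bool" where
  "is_3graph H \<longleftrightarrow> finite (verts H) \<and> edges H \<subseteq> triples (verts H)"

definition iso :: "'a hypergraph \<Rightarrow> 'b hypergraph \<Rightarrow> bool" where
  "iso G H \<longleftrightarrow> (\<exists>f. bij_betw f (verts G) (verts H) \<and> (\<lambda>e. f ` e) ` edges G = edges H)"

(* The isomorphism type of a 3-graph, with vertices of any type, is represented by the class
   of its copies on vertex sets of natural numbers; as 3-graphs are finite, this class is
   non-empty and determines the 3-graph up to isomorphism. *)
definition iso_type :: "'a hypergraph \<Rightarrow> nat hypergraph set" where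
  "iso_type H = {G. is_3graph G \<and> iso H G}"

(* Containment as a not necessarily induced sub-3-graph. *)
definition contains_copy :: "'a hypergraph \<Rightarrow> 'b hypergraph \<Rightarrow> bool" where
  "contains_copy G F \<longleftrightarrow>
     (\<exists>f. inj_on f (verts F) \<and> f ` verts F \<subseteq> verts G \<and> (\<forall>e\<in>edges F. f ` e \<in> edges G))"

definition free_3graphs :: "nat \<Rightarrow> 'b hypergraph \<Rightarrow> nat hypergraph set" where
  "free_3graphs n F = {H. is_3graph H \<and> card (verts H) = n \<and> \<not> contains_copy H F}"

(* The maximum is taken over a finite set, as an n-vertex 3-graph has at most
   (n choose 3) edges; it is non-empty whenever F has an edge. *)
definition turan_number :: "nat \<Rightarrow> 'b hypergraph \<Rightarrow> nat" where
  "turan_number n F = Max ((\<lambda>H. card (edges H)) ` free_3graphs n F)"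

definition extremal_family :: "nat \<Rightarrow> 'b hypergraph \<Rightarrow> nat hypergraph set set" where
  "extremal_family n F = iso_type ` {H \<in> free_3graphs n F. card (edges H) = turan_number n F}"

definition M2 :: "nat hypergraph" where
  "M2 = Hypergraph {0, 1, 2, 3, 4, 5} {{0, 1, 2}, {3, 4, 5}}"

definition full_star :: "nat \<Rightarrow> nat hypergraph" where
  "full_star n = Hypergraph {..<n} {e \<in> triples {..<n}. 0 \<in> e}"

definition complete_3graph :: "nat \<Rightarrow> nat hypergraph" where
  "complete_3graph n = Hypergraph {..<n} (triples {..<n})"

definition add_isolated :: "'a hypergraph \<Rightarrow> nat \<Rightarrow> ('a + nat) hypergraph" where
  "add_isolated H s = Hypergraph (Inl ` verts H \<union> Inr ` {..<s}) ((\<lambda>e. Inl ` e) ` edges H)"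

datatype vertex = vx | vy | vz | vv | vw | vu

definition up :: "vertex set \<Rightarrow> vertex set set" where
  "up A = {f \<in> triples UNIV. A \<subseteq> f}"

definition H1 :: "vertex hypergraph" where
  "H1 = Hypergraph UNIV (up {vx, vy} \<union> up {vx, vz} \<union> up {vx, vv} \<union> {{vy, vz, vv}})"

definition H2 :: "vertex hypergraph" where
  "H2 = Hypergraph UNIV (up {vx, vy} \<union> up {vx, vz} \<union> up {vy, vz})"

definition H3 :: "vertex hypergraph" where
  "H3 = Hypergraph UNIV
     (up {vx, vy} \<union> up {vx, vz} \<union> {{vx, vv, vw}, {vy, vz, vw}, {vy, vz, vv}})"

definition H4 :: "vertex hypergraph" where
  "H4 = Hypergraph UNIV
     (up {vx, vy} \<union> {{vx, vv, vz}, {vx, vw, vz}, {vx, vv, vw},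
                      {vy, vz, vw}, {vy, vz, vv}, {vy, vv, vw}})"

definition H5 :: "vertex hypergraph" where
  "H5 = Hypergraph UNIV
     (up {vx, vy} \<union> {{vx, vv, vz}, {vx, vw, vu}, {vx, vv, vw},
                      {vy, vz, vw}, {vy, vu, vv}, {vy, vv, vw}})"

definition H6 :: "vertex hypergraph" where
  "H6 = Hypergraph UNIV
     (up {vx, vy} \<union> {{vx, vv, vz}, {vx, vw, vu}, {vx, vv, vw},
                      {vy, vz, vw}, {vy, vu, vv}, {vx, vz, vu}})"

(* Ux i and Uy i stand for x_i and y_i; only the indices 1, 2, 3 are used. *)
datatype tvertex = Ux nat | Uy nat

definition U :: "tvertex set" where
  "U = {Ux 1, Ux 2, Ux 3, Uy 1, Uy 2, Uy 3}"

definition C3 :: "tvertex set set" where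
  "C3 = {{Ux 1, Uy 3, Ux 2}, {Ux 1, Uy 2, Ux 3}, {Ux 2, Uy 1, Ux 3}}"

definition A1 :: "tvertex set set" where
  "A1 = {{Ux i, Uy i, Uy j} | i j. i \<in> {1, 2, 3} \<and> j \<in> {1, 2, 3} \<and> i \<noteq> j}"

definition A2 :: "tvertex set set" where
  "A2 = {{Ux i, Ux j, Uy j} | i j. i \<in> {1, 2, 3} \<and> j \<in> {1, 2, 3} \<and> i \<noteq> j}"

definition A3 :: "tvertex set set" where
  "A3 = (A1 - {{Ux 1, Uy 1, Uy 2}}) \<union> {{Ux 2, Ux 3, Uy 3}}"

definition A4 :: "tvertex set set" where
  "A4 = (A1 - {{Ux 1, Uy 1, Uy 2}, {Ux 1, Uy 1, Uy 3}})
        \<union> {{Ux 2, Ux 3, Uy 3}, {Ux 2, Ux 3, Uy 2}}"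

definition H7 :: "tvertex hypergraph" where
  "H7 = Hypergraph U (C3 \<union> {{Ux 1, Ux 2, Ux 3}} \<union> A1)"

definition H8 :: "tvertex hypergraph" where
  "H8 = Hypergraph U (C3 \<union> {{Uy 1, Uy 2, Uy 3}} \<union> A1)"

definition H9 :: "tvertex hypergraph" where
  "H9 = Hypergraph U (C3 \<union> {{Uy 1, Uy 2, Uy 3}} \<union> A2)"

definition H10 :: "tvertex hypergraph" where
  "H10 = Hypergraph U (C3 \<union> {{Uy 1, Uy 2, Uy 3}} \<union> A3)"

definition H11 :: "tvertex hypergraph" where
  "H11 = Hypergraph U (C3 \<union> {{Uy 1, Uy 2, Uy 3}} \<union> A4)"

end

theory Submission
  imports Defs
begin

text \<open>Twenty triples on six vertices form ten complementary pairs, so an intersecting family has at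
  most ten of them, and it has ten if and only if it picks one triple from every pair. Up to
  isomorphism these choices are enumerated by branching on one pair at a time; a branch is cut off
  as soon as its partial family contains a copy of a partial family that has been dealt with
  already. This reduces the classification to 52 case distinctions.\<close>

subsection \<open>Isomorphism of 3-graphs\<close>

text \<open>The inverse of \<open>f\<close> undoes \<open>f\<close> only on subsets of
  \<open>verts G\<close>. The second hypothesis places every edge there, so each edge is recovered
  from its image.\<close>

lemma iso_sym:
  assumes "iso G H" and "edges G \<subseteq> Pow (verts G)"
  shows "iso H G"
proof -
  obtain f where f: "bij_betw f (verts G) (verts H)" and im: "(\<lambda>e. f ` e) ` edges G = edges H"
    using assms(1) by (auto simp: iso_def)
  let ?g = "inv_into (verts G) f"
  have "?g ` f ` e = e" if "e \<in> edges G" for e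
    using that assms(2) by (intro inv_into_image_cancel bij_betw_imp_inj_on[OF f]) auto
  then have "(\<lambda>e. ?g ` e) ` edges H = edges G"
    by (simp add: im[symmetric] image_image)
  then show ?thesis
    using bij_betw_inv_into[OF f] by (auto simp: iso_def)
qed

lemma iso_trans:
  assumes "iso G H" and "iso H K"
  shows "iso G K"
proof -
  obtain f g where "bij_betw f (verts G) (verts H)" "(\<lambda>e. f ` e) ` edges G = edges H"
    "bij_betw g (verts H) (verts K)" "(\<lambda>e. g ` e) ` edges H = edges K"
    using assms by (auto simp: iso_def)
  then have "bij_betw (g \<circ> f) (verts G) (verts K)" "(\<lambda>e. (g \<circ> f) ` e) ` edges G = edges K"
    by (auto intro: bij_betw_trans simp: image_image[symmetric] image_comp[symmetric]
        simp del: image_image)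
  then show ?thesis
    unfolding iso_def by blast
qed

text \<open>\<open>G\<close> and \<open>H\<close> may have vertices of different types, so graphs on
  the labels 0 to 5 can be compared with graphs on \<open>vertex\<close> or
  \<open>tvertex\<close>.\<close>

lemma iso_type_eqI:
  assumes "iso G H" and "edges G \<subseteq> Pow (verts G)"
  shows "iso_type G = iso_type H"
  using iso_trans[OF iso_sym[OF assms]] iso_trans[OF assms(1)] by (auto simp: iso_type_def)

subsection \<open>Intersecting families of triples\<close>

text \<open>The case \<open>e = e'\<close> excludes only the empty set, so for triples this is the
  usual notion of pairwise intersecting.\<close>

definition intersecting :: "'a set set \<Rightarrow> bool" where
  "intersecting E \<longleftrightarrow> (\<forall>e\<in>E. \<forall>e'\<in>E. e \<inter> e' \<noteq> {})"

lemma contains_M2_iff: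
  assumes "edges H \<subseteq> triples (verts H)"
  shows "contains_copy H M2 \<longleftrightarrow> \<not> intersecting (edges H)"
proof
  assume "contains_copy H M2"
  then obtain f :: "nat \<Rightarrow> 'a" where inj: "inj_on f {0, 1, 2, 3, 4, 5}"
    and "f ` {0, 1, 2} \<in> edges H" "f ` {3, 4, 5} \<in> edges H"
    by (auto simp: contains_copy_def M2_def)
  moreover have "f ` {0, 1, 2} \<inter> f ` {3, 4, 5} = {}"
    by (subst inj_on_image_Int[OF inj, symmetric]) auto
  ultimately show "\<not> intersecting (edges H)"
    by (meson intersecting_def)
next
  assume "\<not> intersecting (edges H)"
  then obtain e e' where e: "e \<in> edges H" "e' \<in> edges H" "e \<inter> e' = {}"
    by (auto simp: intersecting_def)
  with assms have sub: "e \<subseteq> verts H" "e' \<subseteq> verts H" and "card e = 3" "card e' = 3"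
    by (auto simp: triples_def)
  then obtain a b c a' b' c' where abc: "e = {a, b, c}" "a \<noteq> b" "b \<noteq> c" "a \<noteq> c"
    and abc': "e' = {a', b', c'}" "a' \<noteq> b'" "b' \<noteq> c'" "a' \<noteq> c'"
    by (auto simp: card_3_iff)
  \<comment> \<open>Indexing the list sends the two edges of \<open>M2\<close> to \<open>e\<close>
    and \<open>e'\<close>; it is injective because these are disjoint.\<close>
  let ?f = "(!) [a, b, c, a', b', c']"
  have "inj_on ?f {0, 1, 2, 3, 4, 5}"
    using e(3) abc abc' by (auto simp: inj_on_def)
  moreover have "?f ` {0, 1, 2} = e" "?f ` {3, 4, 5} = e'"
    using abc abc' by (simp_all add: insert_commute)
  ultimately show "contains_copy H M2"
    using e sub unfolding contains_copy_def M2_def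
    by (intro exI[of _ ?f]) auto
qed

text \<open>The complements of the members form a second family of triples, of the same size as
  \<open>E\<close> and disjoint from it. Together they fit into the twenty triples, and if
  \<open>E\<close> has ten members they fill them up.\<close>

lemma intersecting_triples:
  assumes "card V = 6" and "E \<subseteq> triples V" and "intersecting E"
  shows "card E \<le> 10"
    and "card E = 10 \<Longrightarrow> e \<in> triples V \<Longrightarrow> e \<in> E \<or> V - e \<in> E"
proof -
  \<comment> \<open>An infinite set has \<open>card\<close> 0, so a positive size gives
    finiteness.\<close>
  have fin: "finite V"
    using assms(1) card.infinite by fastforce
  have card_triples: "card (triples V) = 20"
    using n_subsets[OF fin, of 3] assms(1)
    by (simp add: triples_def numeral_eq_Suc)
  have fin_triples: "finite (triples V)"
    using fin by (simp add: triples_def)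
  let ?C = "(\<lambda>e. V - e) ` E"
  \<comment> \<open>A common element would be a member of \<open>E\<close> disjoint from another
    member.\<close>
  have disj: "E \<inter> ?C = {}"
    using assms(3) by (fastforce simp: intersecting_def)
  have "inj_on (\<lambda>e. V - e) E"
    using assms(2) by (auto simp: inj_on_def triples_def)
  then have card_C: "card ?C = card E"
    by (rule card_image)
  have sub: "E \<union> ?C \<subseteq> triples V"
    using assms fin by (auto simp: triples_def card_Diff_subset finite_subset)
  then have "finite E" "finite ?C"
    using fin_triples finite_subset by blast+
  then have card_Un: "card (E \<union> ?C) = card E + card E"
    using card_Un_disjoint[OF _ _ disj] card_C by simp
  then show "card E \<le> 10"
    using card_mono[OF fin_triples sub] card_triples by simp
  show "e \<in> E \<or> V - e \<in> E" if "card E = 10" "e \<in> triples V"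
  proof -
    have "E \<union> ?C = triples V"
      using that(1) card_Un card_triples by (intro card_subset_eq[OF fin_triples sub]) simp
    with that(2) have "e \<in> E \<union> ?C"
      by simp
    then consider "e \<in> E" | e' where "e' \<in> E" "e = V - e'"
      by blast
    then show ?thesis
    proof cases
      case 2
      then have "V - e = e'"
        using assms(2) by (auto simp: triples_def)
      with 2 show ?thesis by simp
    qed simp
  qed
qed

subsection \<open>The thirteen representatives\<close>

definition list_graph :: "nat list list \<Rightarrow> nat hypergraph" where
  "list_graph L = Hypergraph {..<6} (set ` set L)"

text \<open>The order is S_6, K_5 with an isolated vertex, H_1 to H_11. The labels 0 to 5 stand for
  x, y, z, v, w, u in H_1 to H_6 and for x_1, x_2, x_3, y_1, y_2, y_3 in H_7 to H_11.\<close>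

definition reps :: "nat list list list" where
  "reps =
    [[[0, 1, 2], [0, 1, 3], [0, 1, 4], [0, 1, 5], [0, 2, 3], [0, 2, 4], [0, 2, 5], [0, 3, 4],
     [0, 3, 5], [0, 4, 5]],
     [[0, 1, 2], [0, 1, 3], [0, 1, 4], [0, 2, 3], [0, 2, 4], [0, 3, 4], [1, 2, 3], [1, 2, 4],
     [1, 3, 4], [2, 3, 4]],
     [[0, 1, 2], [0, 1, 3], [0, 1, 4], [0, 1, 5], [0, 2, 3], [0, 2, 4], [0, 2, 5], [0, 3, 4],
     [0, 3, 5], [1, 2, 3]],
     [[0, 1, 2], [0, 1, 3], [0, 1, 4], [0, 1, 5], [0, 2, 3], [0, 2, 4], [0, 2, 5], [1, 2, 3],
     [1, 2, 4], [1, 2, 5]],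
     [[0, 1, 2], [0, 1, 3], [0, 1, 4], [0, 1, 5], [0, 2, 3], [0, 2, 4], [0, 2, 5], [0, 3, 4],
     [1, 2, 3], [1, 2, 4]],
     [[0, 1, 2], [0, 1, 3], [0, 1, 4], [0, 1, 5], [0, 2, 3], [0, 2, 4], [0, 3, 4], [1, 2, 3],
     [1, 2, 4], [1, 3, 4]],
     [[0, 1, 2], [0, 1, 3], [0, 1, 4], [0, 1, 5], [0, 2, 3], [0, 3, 4], [0, 4, 5], [1, 2, 4],
     [1, 3, 4], [1, 3, 5]],
     [[0, 1, 2], [0, 1, 3], [0, 1, 4], [0, 1, 5], [0, 2, 3], [0, 2, 5], [0, 3, 4], [0, 4, 5],
     [1, 2, 4], [1, 3, 5]],
     [[0, 1, 2], [0, 1, 5], [0, 2, 4], [0, 3, 4], [0, 3, 5], [1, 2, 3], [1, 3, 4], [1, 4, 5],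
     [2, 3, 5], [2, 4, 5]],
     [[0, 1, 5], [0, 2, 4], [0, 3, 4], [0, 3, 5], [1, 2, 3], [1, 3, 4], [1, 4, 5], [2, 3, 5],
     [2, 4, 5], [3, 4, 5]],
     [[0, 1, 3], [0, 1, 4], [0, 1, 5], [0, 2, 3], [0, 2, 4], [0, 2, 5], [1, 2, 3], [1, 2, 4],
     [1, 2, 5], [3, 4, 5]],
     [[0, 1, 5], [0, 2, 4], [0, 3, 5], [1, 2, 3], [1, 2, 5], [1, 3, 4], [1, 4, 5], [2, 3, 5],
     [2, 4, 5], [3, 4, 5]],
     [[0, 1, 5], [0, 2, 4], [1, 2, 3], [1, 2, 4], [1, 2, 5], [1, 3, 4], [1, 4, 5], [2, 3, 5],
     [2, 4, 5], [3, 4, 5]]]"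

definition triple_list :: "nat list \<Rightarrow> bool" where
  "triple_list t \<longleftrightarrow> length t = 3 \<and> distinct t \<and> (\<forall>x\<in>set t. x < 6)"

lemma triple_list_set:
  assumes "triple_list t"
  shows "set t \<in> triples {..<6}"
  using assms by (auto simp: triple_list_def triples_def distinct_card)

text \<open>An executable test. Sorting before \<open>distinct\<close> makes the triples differ as
  sets and not merely as lists.\<close>

definition extremal_list :: "nat list list \<Rightarrow> bool" where
  "extremal_list L \<longleftrightarrow> length L = 10 \<and> distinct (map sort L) \<and> list_all triple_list L \<and>
     (\<forall>s\<in>set L. \<forall>t\<in>set L. \<exists>x\<in>set s. x \<in> set t)"

lemma reps_extremal: "list_all extremal_list reps"
  by code_simp

lemma extremal_list_graph:
  assumes "extremal_list L"
  shows "set ` set L \<subseteq> triples {..<6}" and "intersecting (set ` set L)"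
    and "card (set ` set L) = 10"
proof -
  show "set ` set L \<subseteq> triples {..<6}"
    using assms triple_list_set by (auto simp: extremal_list_def list_all_iff)
  show "intersecting (set ` set L)"
    using assms by (fastforce simp: extremal_list_def intersecting_def)
  have "inj_on set (set L)"
  proof
    fix s t assume st: "s \<in> set L" "t \<in> set L" "set s = set t"
    then have "sort s = sort t"
      using assms
      by (intro sorted_distinct_set_unique) (auto simp: extremal_list_def list_all_iff triple_list_def)
    with st assms show "s = t"
      by (auto simp: extremal_list_def distinct_map inj_on_def)
  qed
  moreover have "distinct L"
    using assms by (auto simp: extremal_list_def distinct_map)
  ultimately show "card (set ` set L) = 10"
    using assms by (simp add: card_image distinct_card extremal_list_def)
qed

subsection \<open>The case distinction\<close>

text \<open>A list of triples of the labels 0 to 5 stands for a partial family; \<open>g\<close> names the vertex of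
  each label, so that a permutation of the labels is absorbed into \<open>g\<close>.\<close>

definition settled :: "nat list list \<Rightarrow> bool" where
  "settled S \<longleftrightarrow> (\<forall>(V :: nat set) E g. card V = 6 \<and> E \<subseteq> triples V \<and> intersecting E \<and>
     card E = 10 \<and> bij_betw g {..<6} V \<and> (\<forall>s\<in>set S. g ` set s \<in> E) \<longrightarrow>
     (\<exists>L\<in>set reps. iso (list_graph L) (Hypergraph V E)))"

text \<open>The base case of the search: the copy of \<open>L\<close> inside \<open>E\<close> has
  ten triples already, so it is all of \<open>E\<close>.\<close>

lemma settled_rep:
  assumes "L \<in> set reps"
  shows "settled L"
  unfolding settled_def
proof (intro allI impI, elim conjE)
  fix V :: "nat set" and E g
  assume E: "card V = 6" "E \<subseteq> triples V" "card E = 10"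
    and g: "bij_betw g {..<6} V" and sub: "\<forall>s\<in>set L. g ` set s \<in> E"
  have L: "extremal_list L"
    using assms reps_extremal by (simp add: list_all_iff)
  have "inj_on (\<lambda>e. g ` e) (set ` set L)"
    using extremal_list_graph(1)[OF L]
    by (intro inj_on_subset[OF inj_on_image_Pow[OF bij_betw_imp_inj_on[OF g]]])
      (auto simp: triples_def)
  then have "card ((\<lambda>e. g ` e) ` set ` set L) = 10"
    using extremal_list_graph(3)[OF L] by (simp add: card_image)
  moreover have "finite E"
    using E(3) card.infinite by fastforce
  ultimately have "(\<lambda>e. g ` e) ` set ` set L = E"
    using sub E(3) by (intro card_subset_eq) auto
  then have "iso (list_graph L) (Hypergraph V E)"
    using g by (auto simp: iso_def list_graph_def)
  with assms show "\<exists>L\<in>set reps. iso (list_graph L) (Hypergraph V E)" ..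
qed

text \<open>The list \<open>p\<close> encodes a permutation of the labels. Triples are compared
  through \<open>set\<close>, so the order of their entries does not matter, and the bound on the
  entries of \<open>t\<close> keeps each lookup inside \<open>p\<close>.\<close>

definition maps_into :: "nat list \<Rightarrow> nat list list \<Rightarrow> nat list list \<Rightarrow> bool" where
  "maps_into p T S \<longleftrightarrow> length p = 6 \<and> distinct p \<and> (\<forall>x\<in>set p. x < 6) \<and>
     (\<forall>t\<in>set T. \<exists>s\<in>set S. (\<forall>x\<in>set t. x < 6) \<and> set (map ((!) p) t) = set s)"

text \<open>This justifies cutting off a branch: a family that contains \<open>S\<close> under the
  labelling \<open>g\<close> contains \<open>T\<close> under \<open>g\<close> composed with
  \<open>p\<close>, and \<open>T\<close> has been dealt with.\<close>

lemma settled_maps_into: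
  assumes "settled T" and "maps_into p T S"
  shows "settled S"
  unfolding settled_def
proof (intro allI impI, elim conjE)
  fix V :: "nat set" and E g
  assume E: "card V = 6" "E \<subseteq> triples V" "intersecting E" "card E = 10"
    and g: "bij_betw g {..<6} V" and sub: "\<forall>s\<in>set S. g ` set s \<in> E"
  have p: "length p = 6" "distinct p" "set p \<subseteq> {..<6}"
    using assms(2) by (auto simp: maps_into_def)
  then have "set p = {..<6}"
    by (intro card_subset_eq) (auto simp: distinct_card)
  then have "bij_betw ((!) p) {..<6} {..<6}"
    using p(1,2) by (intro bij_betw_nth) simp_all
  then have "bij_betw (g \<circ> (!) p) {..<6} V"
    using g by (rule bij_betw_trans)
  moreover have "(g \<circ> (!) p) ` set t \<in> E" if "t \<in> set T" for t
  proof -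
    have "\<exists>s\<in>set S. (!) p ` set t = set s"
      using assms(2) that by (simp add: maps_into_def)
    then obtain s where "s \<in> set S" "(!) p ` set t = set s" ..
    with sub show ?thesis
      by (simp only: image_comp[symmetric])
  qed
  ultimately show "\<exists>L\<in>set reps. iso (list_graph L) (Hypergraph V E)"
    using assms(1) E unfolding settled_def by blast
qed

text \<open>A family of ten triples contains one triple of every complementary pair, so the two
  extensions of \<open>S\<close> cover all cases.\<close>

lemma settled_branch:
  assumes "triple_list t" and "settled (t # S)" and "settled (filter (\<lambda>x. x \<notin> set t) [0..<6] # S)"
  shows "settled S"
  unfolding settled_def
proof (intro allI impI, elim conjE)
  fix V :: "nat set" and E g
  assume E: "card V = 6" "E \<subseteq> triples V" "intersecting E" "card E = 10"
    and g: "bij_betw g {..<6} V" and sub: "\<forall>s\<in>set S. g ` set s \<in> E"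
  have t: "set t \<subseteq> {..<6}" "card (set t) = 3"
    using triple_list_set[OF assms(1)] by (auto simp: triples_def)
  have inj: "inj_on g {..<6}" and im: "g ` {..<6} = V"
    using g by (auto simp: bij_betw_def)
  \<comment> \<open>The complement is given as a list of labels. As \<open>g\<close> is a bijection,
    it turns complements among the labels into complements in \<open>V\<close>.\<close>
  have "set (filter (\<lambda>x. x \<notin> set t) [0..<6]) = {..<6} - set t"
    by auto
  then have compl: "g ` set (filter (\<lambda>x. x \<notin> set t) [0..<6]) = V - g ` set t"
    using inj_on_image_set_diff[OF inj, of "{..<6}" "set t"] t(1) im by auto
  have "g ` set t \<in> triples V"
    using t im card_image[OF inj_on_subset[OF inj t(1)]] by (auto simp: triples_def)
  then have "g ` set t \<in> E \<or> V - g ` set t \<in> E"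
    using intersecting_triples(2)[OF E(1-3)] E(4) by blast
  then consider "\<forall>s\<in>set (t # S). g ` set s \<in> E"
    | "\<forall>s\<in>set (filter (\<lambda>x. x \<notin> set t) [0..<6] # S). g ` set s \<in> E"
    using sub by (simp only: list.set ball_simps compl) blast
  then show "\<exists>L\<in>set reps. iso (list_graph L) (Hypergraph V E)"
    using assms(2,3) E g unfolding settled_def by cases blast+
qed

text \<open>A step \<open>(S, t, i, p, j, q)\<close> settles \<open>S\<close> by distinguishing whether the triple \<open>t\<close> or its
  complement is present; the permutations \<open>p\<close> and \<open>q\<close> embed the partial families number \<open>i\<close> and
  \<open>j\<close>, which have been settled before, into the respective extension of \<open>S\<close>.\<close>

type_synonym step =
  "nat list list \<times> nat list \<times> nat \<times> nat list \<times> nat \<times> nat list"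

text \<open>\<open>Ts\<close> collects what is settled so far. Starting from the 13 entries of
  \<open>reps\<close>, the families of the steps receive the indices 13, 14 and so on. The final
  check asks for the empty partial family, which lies in every family.\<close>

fun valid_steps :: "nat list list list \<Rightarrow> step list \<Rightarrow> bool" where
  "valid_steps Ts [] \<longleftrightarrow> [] \<in> set Ts"
| "valid_steps Ts ((S, t, i, p, j, q) # steps) \<longleftrightarrow>
     triple_list t \<and> i < length Ts \<and> j < length Ts \<and>
     maps_into p (Ts ! i) (t # S) \<and>
     maps_into q (Ts ! j) (filter (\<lambda>x. x \<notin> set t) [0..<6] # S) \<and>
     valid_steps (Ts @ [S]) steps"

text \<open>The invariant of the induction is that all entries of \<open>Ts\<close> are settled; a
  valid step preserves it by one branching and two embeddings.\<close>

lemma settled_if_valid_steps: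
  assumes "valid_steps Ts steps" and "\<forall>T\<in>set Ts. settled T"
  shows "settled []"
  using assms
proof (induction Ts steps rule: valid_steps.induct)
  case (2 Ts S t i p j q steps)
  then have t: "triple_list t" and Ts: "settled (Ts ! i)" "settled (Ts ! j)"
    and into: "maps_into p (Ts ! i) (t # S)"
      "maps_into q (Ts ! j) (filter (\<lambda>x. x \<notin> set t) [0..<6] # S)"
    and valid: "valid_steps (Ts @ [S]) steps"
    by simp_all
  have "settled S"
    using settled_branch[OF t] settled_maps_into Ts into by blast
  with "2.prems"(2) show ?case
    by (intro "2.IH"[OF valid]) simp
qed simp

text \<open>The steps were found by a computer search over the isomorphism types of partial families.\<close>

definition steps :: "step list" where
  "steps =
    [([[0, 1, 2], [0, 1, 3], [0, 1, 4], [0, 1, 5], [0, 2, 3], [0, 2, 4], [0, 2, 5], [0, 3, 4],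
     [0, 3, 5]], [0, 4, 5], 0, [0, 1, 2, 3, 4, 5], 2, [0, 1, 2, 3, 4, 5]),
     ([[0, 1, 2], [0, 1, 3], [0, 1, 4], [0, 2, 5], [0, 3, 5], [0, 4, 5], [1, 2, 5], [1, 3, 5],
     [2, 3, 4]], [0, 2, 3], 11, [4, 1, 2, 5, 3, 0], 10, [0, 1, 5, 2, 3, 4]),
     ([[0, 1, 2], [0, 1, 3], [0, 1, 4], [0, 1, 5], [0, 2, 3], [0, 2, 4], [0, 2, 5], [0, 3, 4],
     [1, 2, 3]], [0, 3, 5], 2, [0, 1, 2, 3, 4, 5], 4, [0, 1, 2, 3, 4, 5]),
     ([[0, 1, 2], [0, 1, 3], [0, 1, 4], [0, 1, 5], [0, 2, 3], [0, 2, 4], [0, 3, 5], [1, 2, 3],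
     [1, 2, 5]], [0, 2, 5], 4, [0, 1, 2, 3, 5, 4], 6, [0, 1, 4, 2, 3, 5]),
     ([[0, 1, 2], [0, 1, 3], [0, 1, 4], [0, 2, 3], [0, 2, 4], [0, 3, 5], [1, 2, 3], [1, 3, 4],
     [2, 3, 4]], [0, 3, 4], 5, [0, 3, 1, 2, 4, 5], 12, [5, 0, 1, 4, 2, 3]),
     ([[0, 1, 2], [0, 1, 3], [0, 1, 4], [0, 1, 5], [0, 2, 3], [0, 2, 4], [0, 3, 4], [1, 2, 3],
     [1, 2, 4]], [0, 2, 5], 4, [0, 1, 2, 3, 4, 5], 5, [0, 1, 2, 3, 4, 5]),
     ([[0, 1, 2], [0, 1, 3], [0, 1, 4], [0, 1, 5], [0, 2, 3], [0, 2, 4], [0, 2, 5], [1, 2, 3],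
     [1, 2, 4]], [0, 3, 4], 4, [0, 1, 2, 3, 4, 5], 3, [0, 1, 2, 3, 4, 5]),
     ([[0, 1, 2], [0, 1, 3], [0, 1, 4], [0, 1, 5], [0, 2, 3], [0, 2, 4], [0, 3, 5], [1, 2, 5],
     [1, 3, 4]], [0, 4, 5], 7, [0, 1, 2, 3, 5, 4], 6, [0, 1, 4, 2, 3, 5]),
     ([[0, 1, 2], [0, 1, 3], [0, 1, 4], [0, 2, 3], [0, 2, 5], [0, 4, 5], [1, 2, 4], [1, 2, 5],
     [1, 3, 5]], [0, 1, 5], 6, [0, 1, 3, 2, 5, 4], 9, [3, 4, 5, 0, 1, 2]),
     ([[0, 1, 2], [0, 1, 3], [0, 1, 4], [0, 2, 3], [0, 2, 4], [0, 3, 4], [1, 2, 3], [1, 2, 4],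
     [1, 3, 4]], [0, 1, 5], 5, [0, 1, 2, 3, 4, 5], 1, [0, 1, 2, 3, 4, 5]),
     ([[0, 1, 2], [0, 1, 3], [0, 1, 4], [0, 2, 3], [0, 2, 4], [0, 3, 5], [1, 2, 5], [1, 3, 4],
     [2, 3, 4]], [0, 4, 5], 11, [5, 3, 1, 4, 2, 0], 12, [5, 0, 1, 4, 2, 3]),
     ([[0, 1, 2], [0, 1, 3], [0, 2, 4], [0, 3, 5], [0, 4, 5], [1, 2, 5], [1, 3, 4], [1, 4, 5],
     [2, 3, 4]], [0, 1, 4], 9, [2, 3, 5, 0, 1, 4], 8, [0, 1, 2, 5, 4, 3]),
     ([[0, 1, 2], [0, 1, 3], [0, 1, 4], [0, 2, 3], [0, 2, 5], [0, 4, 5], [1, 2, 4], [1, 3, 5],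
     [2, 3, 4]], [0, 3, 4], 11, [5, 2, 1, 4, 3, 0], 9, [3, 4, 5, 0, 1, 2]),
     ([[0, 1, 2], [0, 1, 3], [0, 1, 4], [0, 2, 3], [0, 4, 5], [1, 2, 5], [1, 3, 5], [2, 3, 4]],
     [0, 3, 5], 25, [0, 3, 1, 2, 5, 4], 25, [1, 0, 2, 4, 3, 5]),
     ([[0, 1, 2], [0, 1, 3], [0, 2, 4], [0, 3, 5], [0, 4, 5], [1, 2, 5], [1, 3, 4], [2, 3, 4]],
     [0, 2, 3], 25, [0, 2, 3, 1, 4, 5], 24, [0, 1, 2, 3, 4, 5]),
     ([[0, 1, 2], [0, 1, 3], [0, 1, 4], [0, 2, 3], [0, 2, 4], [0, 3, 4], [1, 2, 3], [1, 2, 4]],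
     [0, 1, 5], 18, [0, 1, 2, 3, 4, 5], 22, [0, 2, 1, 3, 4, 5]),
     ([[0, 1, 2], [0, 1, 3], [0, 1, 4], [0, 2, 3], [0, 2, 4], [0, 3, 5], [1, 2, 3], [1, 3, 4]],
     [0, 1, 5], 16, [0, 1, 3, 2, 5, 4], 17, [0, 1, 2, 3, 4, 5]),
     ([[0, 1, 2], [0, 1, 3], [0, 1, 4], [0, 2, 3], [0, 2, 5], [0, 4, 5], [1, 2, 4], [1, 2, 5]],
     [0, 1, 5], 16, [0, 1, 2, 5, 3, 4], 21, [0, 2, 1, 3, 5, 4]),
     ([[0, 1, 2], [0, 1, 3], [0, 1, 4], [0, 1, 5], [0, 2, 3], [0, 2, 4], [0, 3, 4], [1, 2, 3]],
     [0, 2, 5], 15, [0, 1, 2, 3, 4, 5], 18, [0, 1, 3, 2, 4, 5]),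
     ([[0, 1, 2], [0, 1, 3], [0, 1, 4], [0, 2, 5], [0, 3, 5], [1, 2, 5], [1, 4, 5], [2, 3, 4]],
     [0, 4, 5], 14, [0, 1, 2, 4, 3, 5], 25, [1, 2, 0, 3, 5, 4]),
     ([[0, 1, 2], [0, 1, 3], [0, 1, 4], [0, 1, 5], [0, 2, 3], [0, 2, 4], [1, 2, 3], [1, 2, 5]],
     [0, 3, 5], 16, [0, 1, 2, 3, 4, 5], 19, [1, 0, 2, 3, 4, 5]),
     ([[0, 1, 2], [0, 1, 3], [0, 1, 4], [0, 1, 5], [0, 2, 3], [0, 2, 4], [0, 2, 5], [0, 3, 4]],
     [0, 4, 5], 13, [0, 1, 2, 4, 3, 5], 15, [0, 1, 2, 3, 4, 5]),
     ([[0, 1, 2], [0, 1, 3], [0, 1, 4], [0, 1, 5], [0, 2, 3], [0, 2, 4], [0, 3, 5], [1, 2, 5]],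
     [0, 2, 5], 15, [0, 1, 2, 5, 3, 4], 20, [0, 1, 2, 3, 4, 5]),
     ([[0, 1, 2], [0, 1, 3], [0, 1, 4], [0, 2, 3], [0, 2, 4], [0, 3, 5], [1, 2, 5], [1, 3, 4]],
     [0, 1, 5], 20, [0, 1, 2, 3, 4, 5], 23, [0, 1, 2, 3, 4, 5]),
     ([[0, 1, 2], [0, 1, 3], [0, 1, 4], [0, 2, 3], [0, 2, 4], [1, 2, 3], [1, 3, 4]], [0, 3, 5],
     29, [0, 1, 2, 3, 4, 5], 28, [1, 0, 2, 3, 4, 5]),
     ([[0, 1, 2], [0, 1, 3], [0, 1, 4], [0, 1, 5], [0, 2, 3], [0, 2, 4], [1, 2, 3]], [0, 3, 4],
     31, [0, 1, 2, 3, 4, 5], 33, [0, 1, 2, 3, 4, 5]),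
     ([[0, 1, 2], [0, 1, 3], [0, 1, 4], [0, 2, 3], [0, 2, 5], [1, 2, 4], [1, 3, 5]], [0, 3, 4],
     36, [0, 1, 3, 2, 4, 5], 30, [1, 0, 2, 4, 3, 5]),
     ([[0, 1, 2], [0, 1, 3], [0, 1, 4], [0, 1, 5], [0, 2, 3], [0, 2, 4], [0, 3, 5]], [0, 2, 5],
     34, [0, 1, 2, 3, 5, 4], 35, [0, 1, 3, 2, 5, 4]),
     ([[0, 1, 2], [0, 1, 3], [0, 1, 4], [0, 2, 3], [0, 2, 4], [0, 3, 5], [1, 3, 4]], [0, 3, 4],
     31, [0, 3, 1, 4, 2, 5], 36, [0, 1, 2, 3, 4, 5]),
     ([[0, 1, 2], [0, 1, 3], [0, 1, 4], [0, 2, 5], [0, 3, 5], [1, 2, 5], [2, 3, 4]], [0, 2, 3],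
     36, [0, 2, 3, 1, 5, 4], 32, [0, 1, 2, 3, 4, 5]),
     ([[0, 1, 2], [0, 1, 3], [0, 2, 4], [0, 3, 5], [1, 2, 5], [1, 4, 5], [2, 3, 4]], [0, 2, 5],
     26, [2, 0, 1, 5, 4, 3], 27, [1, 0, 3, 2, 4, 5]),
     ([[0, 1, 2], [0, 1, 3], [0, 1, 4], [0, 2, 3], [0, 4, 5], [1, 2, 5], [2, 3, 4]], [0, 2, 4],
     36, [0, 2, 1, 4, 3, 5], 26, [0, 1, 2, 3, 4, 5]),
     ([[0, 1, 2], [0, 1, 3], [0, 1, 4], [0, 2, 3], [0, 2, 4], [0, 3, 5]], [0, 1, 5], 40, [0, 1,
     2, 3, 4, 5], 41, [0, 2, 1, 3, 4, 5]),
     ([[0, 1, 2], [0, 1, 3], [0, 1, 4], [0, 2, 3], [0, 4, 5], [1, 2, 4]], [0, 3, 4], 41, [0, 1,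
     3, 4, 2, 5], 39, [1, 0, 2, 4, 3, 5]),
     ([[0, 1, 2], [0, 1, 3], [0, 2, 4], [0, 3, 5], [1, 4, 5], [2, 3, 4]], [0, 3, 4], 42, [0, 3,
     4, 1, 5, 2], 43, [0, 1, 2, 3, 4, 5]),
     ([[0, 1, 2], [0, 1, 3], [0, 2, 4], [0, 3, 5], [1, 2, 5], [1, 4, 5]], [0, 1, 5], 39, [1, 0,
     5, 2, 3, 4], 43, [0, 1, 2, 3, 4, 5]),
     ([[0, 1, 2], [0, 1, 3], [0, 1, 4], [0, 2, 3], [0, 2, 5], [1, 2, 4]], [0, 2, 4], 38, [0, 2,
     1, 4, 3, 5], 39, [0, 1, 2, 3, 4, 5]),
     ([[0, 1, 2], [0, 1, 3], [0, 1, 4], [0, 2, 3], [0, 2, 4], [1, 2, 3]], [0, 1, 5], 38, [0, 1,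
     2, 3, 4, 5], 37, [0, 2, 1, 3, 4, 5]),
     ([[0, 1, 2], [0, 1, 3], [0, 2, 3], [0, 4, 5], [1, 2, 4], [1, 3, 5]], [0, 3, 4], 44, [0, 3,
     1, 2, 4, 5], 42, [1, 2, 0, 5, 4, 3]),
     ([[0, 1, 2], [0, 1, 3], [0, 1, 4], [0, 2, 3], [0, 2, 4]], [0, 3, 5], 45, [0, 1, 2, 3, 4,
     5], 50, [0, 1, 2, 4, 3, 5]),
     ([[0, 1, 2], [0, 1, 3], [0, 1, 4], [0, 2, 3], [1, 2, 5]], [0, 2, 5], 49, [0, 2, 1, 3, 5,
     4], 46, [1, 0, 3, 4, 2, 5]),
     ([[0, 1, 2], [0, 1, 3], [0, 2, 4], [1, 4, 5], [2, 3, 5]], [0, 3, 5], 47, [0, 1, 3, 2, 5,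
     4], 51, [2, 1, 0, 4, 3, 5]),
     ([[0, 1, 2], [0, 1, 3], [0, 2, 4], [0, 3, 5], [1, 2, 5]], [0, 1, 5], 46, [0, 1, 5, 3, 2,
     4], 48, [2, 0, 1, 4, 5, 3]),
     ([[0, 1, 2], [0, 1, 3], [0, 4, 5], [2, 3, 4]], [0, 2, 4], 55, [0, 2, 4, 1, 5, 3], 54, [1,
     0, 3, 2, 5, 4]),
     ([[0, 1, 2], [0, 1, 3], [0, 1, 4], [0, 2, 3]], [0, 2, 4], 52, [0, 1, 2, 3, 4, 5], 53, [0,
     1, 3, 2, 4, 5]),
     ([[0, 1, 2], [0, 1, 3], [0, 2, 4], [1, 4, 5]], [0, 1, 4], 53, [0, 1, 4, 2, 3, 5], 54, [0,
     1, 2, 3, 4, 5]),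
     ([[0, 1, 2], [0, 3, 4], [1, 3, 5]], [0, 1, 4], 58, [0, 1, 4, 2, 3, 5], 56, [3, 5, 1, 2, 0,
     4]),
     ([[0, 1, 2], [0, 1, 3], [0, 2, 4]], [0, 1, 4], 57, [0, 1, 2, 4, 3, 5], 58, [0, 2, 1, 4, 3,
     5]),
     ([[0, 1, 2], [0, 3, 4]], [0, 2, 4], 60, [0, 2, 4, 1, 3, 5], 59, [0, 1, 2, 3, 4, 5]),
     ([[0, 1, 2], [0, 1, 3]], [0, 3, 5], 60, [0, 1, 3, 2, 5, 4], 60, [1, 0, 2, 3, 4, 5]),
     ([[0, 1, 2]], [0, 1, 4], 62, [0, 1, 2, 4, 3, 5], 61, [2, 0, 1, 3, 5, 4]),
     ([], [0, 1, 2], 63, [0, 1, 2, 3, 4, 5], 63, [3, 4, 5, 0, 1, 2])]"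

text \<open>The search tree is recorded bottom-up, from partial families of nine triples down to the
  empty one, so every index points to an earlier entry.\<close>

lemma valid_steps_reps: "valid_steps reps steps"
  by code_simp

section \<open>The maximum and the extremal family in terms of the representatives\<close>

lemma extremal_iso_rep:
  assumes "card V = 6" and "E \<subseteq> triples V" and "intersecting E" and "card E = 10"
  shows "\<exists>L\<in>set reps. iso (list_graph L) (Hypergraph (V :: nat set) E)"
proof -
  have "finite V"
    using assms(1) card.infinite by fastforce
  \<comment> \<open>Any labelling will do, since the empty partial family imposes no condition on
    it.\<close>
  then obtain g where "bij_betw g {..<6::nat} V"
    using assms(1) by (metis finite_lessThan finite_same_card_bij card_lessThan)
  then show ?thesis
    using settled_if_valid_steps[OF valid_steps_reps] settled_rep assms
    unfolding settled_def by auto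
qed

lemma free_M2_iff:
  "H \<in> free_3graphs 6 M2 \<longleftrightarrow>
     card (verts H) = 6 \<and> edges H \<subseteq> triples (verts H) \<and> intersecting (edges H)"
proof -
  have "finite (verts H)" if "card (verts H) = 6"
    using that card.infinite by fastforce
  then show ?thesis
    using contains_M2_iff[of H] by (auto simp: free_3graphs_def is_3graph_def)
qed

lemma rep_free:
  assumes "L \<in> set reps"
  shows "list_graph L \<in> free_3graphs 6 M2" and "card (edges (list_graph L)) = 10"
  using extremal_list_graph[of L] reps_extremal assms
  by (auto simp: free_M2_iff list_graph_def list_all_iff)

lemma turan_number_M2: "turan_number 6 M2 = 10"
  unfolding turan_number_def
proof (rule Max_eqI)
  have "(\<lambda>H. card (edges H)) ` free_3graphs 6 M2 \<subseteq> {..10}"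
    using intersecting_triples(1) by (fastforce simp: free_M2_iff)
  then show "finite ((\<lambda>H. card (edges H)) ` free_3graphs 6 M2)"
    using finite_subset by blast
  show "y \<le> 10" if "y \<in> (\<lambda>H. card (edges H)) ` free_3graphs 6 M2" for y
    using that intersecting_triples(1) by (auto simp: free_M2_iff)
  \<comment> \<open>The bound is attained by every representative; the first one serves as
    witness.\<close>
  have "hd reps \<in> set reps"
    by (simp add: reps_def)
  then show "10 \<in> (\<lambda>H. card (edges H)) ` free_3graphs 6 M2"
    using rep_free[of "hd reps"] by (metis image_eqI)
qed

text \<open>The case distinction gives one inclusion; the other holds because each representative is
  itself intersecting with ten edges.\<close>

lemma extremal_family_M2: "extremal_family 6 M2 = (\<lambda>L. iso_type (list_graph L)) ` set reps"
proof -
  have "iso_type H \<in> (\<lambda>L. iso_type (list_graph L)) ` set reps"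
    if H: "H \<in> free_3graphs 6 M2" "card (edges H) = 10" for H
  proof -
    obtain L where L: "L \<in> set reps" "iso (list_graph L) H"
      using extremal_iso_rep[of "verts H" "edges H"] H by (auto simp: free_M2_iff)
    then have "edges (list_graph L) \<subseteq> Pow (verts (list_graph L))"
      using rep_free(1) by (auto simp: free_M2_iff triples_def)
    with L show ?thesis
      using iso_type_eqI by blast
  qed
  then show ?thesis
    using rep_free by (auto simp: extremal_family_def turan_number_M2)
qed

subsection \<open>Identifying the representatives\<close>

text \<open>The list \<open>xs\<close> names the vertex of each label. With it fixed, the
  isomorphism comes down to one equality of explicit edge sets, which can be evaluated.\<close>

lemma iso_type_rep:
  assumes "L \<in> set reps" and "distinct xs" and "length xs = 6"
    and "verts H = set xs" and "(\<lambda>t. (!) xs ` set t) ` set L = edges H"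
  shows "iso_type (list_graph L) = iso_type H"
proof (rule iso_type_eqI)
  have "bij_betw ((!) xs) {..<6} (set xs)"
    using assms(2,3) by (intro bij_betw_nth) auto
  then show "iso (list_graph L) H"
    using assms(4,5) by (auto simp: iso_def list_graph_def image_image)
  show "edges (list_graph L) \<subseteq> Pow (verts (list_graph L))"
    using rep_free(1)[OF assms(1)] by (auto simp: free_M2_iff triples_def)
qed

section \<open>Explicit enumerations of the edge sets\<close>

lemma UNIV_vertex: "UNIV = {vx, vy, vz, vv, vw, vu}"
  using vertex.exhaust by auto

text \<open>A triple containing both points is determined by its third point. The explicit image on
  the right can be evaluated, unlike the comprehension behind \<open>up\<close>.\<close>

lemma up_pair:
  assumes "a \<noteq> b"
  shows "up {a, b} = (\<lambda>c. {a, b, c}) ` ({vx, vy, vz, vv, vw, vu} - {a, b})"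
proof
  show "up {a, b} \<subseteq> (\<lambda>c. {a, b, c}) ` ({vx, vy, vz, vv, vw, vu} - {a, b})"
  proof
    fix f assume "f \<in> up {a, b}"
    then have f: "card f = 3" "{a, b} \<subseteq> f"
      by (auto simp: up_def triples_def)
    then have "card (f - {a, b}) = 1"
      using assms by (simp add: card_Diff_subset)
    then obtain c where "f - {a, b} = {c}"
      by (auto simp: card_1_singleton_iff)
    with f have "f = {a, b, c}" "c \<in> UNIV - {a, b}"
      by auto
    then show "f \<in> (\<lambda>c. {a, b, c}) ` ({vx, vy, vz, vv, vw, vu} - {a, b})"
      unfolding UNIV_vertex by blast
  qed
qed (use assms in \<open>auto simp: up_def triples_def\<close>)

text \<open>Keeping \<open>f\<close> arbitrary lets one enumeration of the index pairs serve both
  \<open>A1\<close> and \<open>A2\<close>.\<close>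

lemma distinct_index_pairs:
  "{f i j | i j. i \<in> {1, 2, 3} \<and> j \<in> {1, 2, 3} \<and> i \<noteq> j} =
     {f 1 2, f 1 3, f 2 1, f 2 3, f 3 1, f (3::nat) (2::nat)}"
proof -
  have "{(i, j). i \<in> {1, 2, 3} \<and> j \<in> {1, 2, 3} \<and> i \<noteq> j} =
      {(1, 2), (1, 3), (2, 1), (2, 3), (3, 1), (3::nat, 2::nat)}"
    by auto
  then have "(\<lambda>(i, j). f i j) ` {(i, j). i \<in> {1, 2, 3} \<and> j \<in> {1, 2, 3} \<and> i \<noteq> j} =
      {f 1 2, f 1 3, f 2 1, f 2 3, f 3 1, f 3 2}"
    by simp
  moreover have "{f i j | i j. P i j} = (\<lambda>(i, j). f i j) ` {(i, j). P i j}" for P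
    by auto
  ultimately show ?thesis
    by (simp only:)
qed

lemma A1_eq: "A1 = {{Ux 1, Uy 1, Uy 2}, {Ux 1, Uy 1, Uy 3}, {Ux 2, Uy 2, Uy 1},
    {Ux 2, Uy 2, Uy 3}, {Ux 3, Uy 3, Uy 1}, {Ux 3, Uy 3, Uy 2}}"
  unfolding A1_def by (rule distinct_index_pairs)

lemma A2_eq: "A2 = {{Ux 1, Ux 2, Uy 2}, {Ux 1, Ux 3, Uy 3}, {Ux 2, Ux 1, Uy 1},
    {Ux 2, Ux 3, Uy 3}, {Ux 3, Ux 1, Uy 1}, {Ux 3, Ux 2, Uy 2}}"
  unfolding A2_def by (rule distinct_index_pairs)

text \<open>The subsequences of a distinct list run through the subsets of its elements, and their
  lengths are the cardinalities, so triples become computable.\<close>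

lemma triples_set:
  assumes "distinct xs"
  shows "triples (set xs) = set (map set (filter (\<lambda>t. length t = 3) (subseqs xs)))"
proof -
  have "card (set t) = length t" if "t \<in> set (subseqs xs)" for t
    using that assms subseqs_distinctD distinct_card by blast
  moreover have "{e. e \<subseteq> set xs} = set ` set (subseqs xs)"
    using subseqs_powset[of xs] by auto
  ultimately show ?thesis
    unfolding triples_def by (auto simp: set_eq_iff)
qed

lemma triples_lessThan:
  "triples {..<n} = set (map set (filter (\<lambda>t. length t = 3) (subseqs [0..<n])))"
  using triples_set[of "[0..<n]"] by (simp add: atLeast0LessThan)

section \<open>The thirteen identifications\<close>

lemma iso_type_full_star: "iso_type (list_graph (reps ! 0)) = iso_type (full_star 6)"
proof (rule iso_type_rep[of _ "[0, 1, 2, 3, 4, 5]"])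
  show "(\<lambda>t. (!) [0, 1, 2, 3, 4, 5] ` set t) ` set (reps ! 0) = edges (full_star 6)"
    unfolding full_star_def hypergraph.sel triples_lessThan by code_simp
qed (auto simp: full_star_def reps_def)

lemma iso_type_K5: "iso_type (list_graph (reps ! 1)) = iso_type (add_isolated (complete_3graph 5) 1)"
\<comment> \<open>Label 5 occurs in no triple of \<open>reps ! 1\<close> and therefore goes to the
  isolated vertex \<open>Inr 0\<close>.\<close>
proof (rule iso_type_rep[of _ "[Inl 0, Inl 1, Inl 2, Inl 3, Inl 4, Inr 0]"])
  show "(\<lambda>t. (!) [Inl 0, Inl 1, Inl 2, Inl 3, Inl 4, Inr 0] ` set t) ` set (reps ! 1) =
      edges (add_isolated (complete_3graph 5) 1)"
    unfolding add_isolated_def complete_3graph_def hypergraph.sel triples_lessThan by code_simp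
  have "{..<5} = {0, 1, 2, 3, 4::nat}"
    by auto
  then show "verts (add_isolated (complete_3graph 5) 1) =
      set [Inl 0, Inl 1, Inl 2, Inl 3, Inl 4, Inr 0]"
    by (auto simp: add_isolated_def complete_3graph_def)
qed (simp_all add: reps_def)

lemma iso_type_H1: "iso_type (list_graph (reps ! 2)) = iso_type H1"
proof (rule iso_type_rep[of _ "[vx, vy, vz, vv, vw, vu]"])
  show "(\<lambda>t. (!) [vx, vy, vz, vv, vw, vu] ` set t) ` set (reps ! 2) = edges H1"
    by (simp only: H1_def hypergraph.sel up_pair vertex.distinct not_False_eq_True) code_simp
qed (simp_all add: H1_def reps_def UNIV_vertex)

lemma iso_type_H2: "iso_type (list_graph (reps ! 3)) = iso_type H2"
proof (rule iso_type_rep[of _ "[vx, vy, vz, vv, vw, vu]"])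
  show "(\<lambda>t. (!) [vx, vy, vz, vv, vw, vu] ` set t) ` set (reps ! 3) = edges H2"
    by (simp only: H2_def hypergraph.sel up_pair vertex.distinct not_False_eq_True) code_simp
qed (simp_all add: H2_def reps_def UNIV_vertex)

lemma iso_type_H3: "iso_type (list_graph (reps ! 4)) = iso_type H3"
proof (rule iso_type_rep[of _ "[vx, vy, vz, vv, vw, vu]"])
  show "(\<lambda>t. (!) [vx, vy, vz, vv, vw, vu] ` set t) ` set (reps ! 4) = edges H3"
    by (simp only: H3_def hypergraph.sel up_pair vertex.distinct not_False_eq_True) code_simp
qed (simp_all add: H3_def reps_def UNIV_vertex)

lemma iso_type_H4: "iso_type (list_graph (reps ! 5)) = iso_type H4"
proof (rule iso_type_rep[of _ "[vx, vy, vz, vv, vw, vu]"])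
  show "(\<lambda>t. (!) [vx, vy, vz, vv, vw, vu] ` set t) ` set (reps ! 5) = edges H4"
    by (simp only: H4_def hypergraph.sel up_pair vertex.distinct not_False_eq_True) code_simp
qed (simp_all add: H4_def reps_def UNIV_vertex)

lemma iso_type_H5: "iso_type (list_graph (reps ! 6)) = iso_type H5"
proof (rule iso_type_rep[of _ "[vx, vy, vz, vv, vw, vu]"])
  show "(\<lambda>t. (!) [vx, vy, vz, vv, vw, vu] ` set t) ` set (reps ! 6) = edges H5"
    by (simp only: H5_def hypergraph.sel up_pair vertex.distinct not_False_eq_True) code_simp
qed (simp_all add: H5_def reps_def UNIV_vertex)

lemma iso_type_H6: "iso_type (list_graph (reps ! 7)) = iso_type H6"
proof (rule iso_type_rep[of _ "[vx, vy, vz, vv, vw, vu]"])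
  show "(\<lambda>t. (!) [vx, vy, vz, vv, vw, vu] ` set t) ` set (reps ! 7) = edges H6"
    by (simp only: H6_def hypergraph.sel up_pair vertex.distinct not_False_eq_True) code_simp
qed (simp_all add: H6_def reps_def UNIV_vertex)

lemma iso_type_H7: "iso_type (list_graph (reps ! 8)) = iso_type H7"
proof (rule iso_type_rep[of _ "[Ux 1, Ux 2, Ux 3, Uy 1, Uy 2, Uy 3]"])
  show "(\<lambda>t. (!) [Ux 1, Ux 2, Ux 3, Uy 1, Uy 2, Uy 3] ` set t) ` set (reps ! 8) = edges H7"
    by (simp only: H7_def hypergraph.sel C3_def A1_eq) code_simp
qed (simp_all add: H7_def reps_def U_def)

lemma iso_type_H8: "iso_type (list_graph (reps ! 9)) = iso_type H8"
proof (rule iso_type_rep[of _ "[Ux 1, Ux 2, Ux 3, Uy 1, Uy 2, Uy 3]"])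
  show "(\<lambda>t. (!) [Ux 1, Ux 2, Ux 3, Uy 1, Uy 2, Uy 3] ` set t) ` set (reps ! 9) = edges H8"
    by (simp only: H8_def hypergraph.sel C3_def A1_eq) code_simp
qed (simp_all add: H8_def reps_def U_def)

lemma iso_type_H9: "iso_type (list_graph (reps ! 10)) = iso_type H9"
proof (rule iso_type_rep[of _ "[Ux 1, Ux 2, Ux 3, Uy 1, Uy 2, Uy 3]"])
  show "(\<lambda>t. (!) [Ux 1, Ux 2, Ux 3, Uy 1, Uy 2, Uy 3] ` set t) ` set (reps ! 10) = edges H9"
    by (simp only: H9_def hypergraph.sel C3_def A2_eq) code_simp
qed (simp_all add: H9_def reps_def U_def)

lemma iso_type_H10: "iso_type (list_graph (reps ! 11)) = iso_type H10"
proof (rule iso_type_rep[of _ "[Ux 1, Ux 2, Ux 3, Uy 1, Uy 2, Uy 3]"])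
  show "(\<lambda>t. (!) [Ux 1, Ux 2, Ux 3, Uy 1, Uy 2, Uy 3] ` set t) ` set (reps ! 11) = edges H10"
    by (simp only: H10_def hypergraph.sel C3_def A3_def A1_eq) code_simp
qed (simp_all add: H10_def reps_def U_def)

lemma iso_type_H11: "iso_type (list_graph (reps ! 12)) = iso_type H11"
proof (rule iso_type_rep[of _ "[Ux 1, Ux 2, Ux 3, Uy 1, Uy 2, Uy 3]"])
  show "(\<lambda>t. (!) [Ux 1, Ux 2, Ux 3, Uy 1, Uy 2, Uy 3] ` set t) ` set (reps ! 12) = edges H11"
    by (simp only: H11_def hypergraph.sel C3_def A4_def A1_eq) code_simp
qed (simp_all add: H11_def reps_def U_def)

theorem proposition1:
  shows "turan_number 6 M2 = 10 \<and>
    extremal_family 6 M2 =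
      {iso_type (full_star 6), iso_type (add_isolated (complete_3graph 5) 1)} \<union>
      {iso_type H1, iso_type H2, iso_type H3, iso_type H4, iso_type H5, iso_type H6,
       iso_type H7, iso_type H8, iso_type H9, iso_type H10, iso_type H11}"
proof
  have "length reps = 13"
    by (simp add: reps_def)
  \<comment> \<open>Writing the set through its indices lets the identifications of the single
    \<open>reps ! k\<close> act as rewrite rules.\<close>
  then have "set reps = (!) reps ` set [0..<13]"
    by (metis map_nth set_map)
  also have "set [0..<13] = {0, 1, 2, 3, 4, 5, 6, 7, 8, 9, 10, 11, 12}"
    by code_simp
  finally show "extremal_family 6 M2 =
      {iso_type (full_star 6), iso_type (add_isolated (complete_3graph 5) 1)} \<union>
      {iso_type H1, iso_type H2, iso_type H3, iso_type H4, iso_type H5, iso_type H6,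
       iso_type H7, iso_type H8, iso_type H9, iso_type H10, iso_type H11}"
    by (simp only: extremal_family_M2 image_insert image_empty iso_type_full_star iso_type_K5
        iso_type_H1 iso_type_H2 iso_type_H3 iso_type_H4 iso_type_H5 iso_type_H6 iso_type_H7
        iso_type_H8 iso_type_H9 iso_type_H10 iso_type_H11 Un_insert_left Un_empty_left)
qed (rule turan_number_M2)

end
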